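(* There is an absolute constant $c>0$, and for every $C_1>0$ there is a constant $C>0$ depending only on $C_1$, such that the following holds. Let $\Phi$ be an $L^2(D)$-normalized eigenfunction of $\mathcal K_{\mathrm{diag}}^{(0)}$ associated with a simple isolated eigenvalue $\rho$, assume $\varepsilon_2\le c\,d_\rho$, let $(\rho_\kappa,\Phi_\kappa)=(\rho+\delta\rho,\Phi+\delta\phi)$ be a corresponding coupled eigenpair of $\mathcal K_D^{(0)}$ with constant $C_1$ (in the sense defined in the context), and assume $|\delta\rho|/|\rho|\le\frac12$. Then $$\|\delta\phi\|_{C^0(\overline D)}\le C\left(\frac{C_0}{|\rho|}\frac{\varepsilon_2}{d_\rho}+\frac{\varepsilon_\infty}{|\rho|}+\frac{\varepsilon_\infty}{|\rho|}\frac{\varepsilon_2}{d_\rho}+\frac{C_0}{|\rho|^2}\varepsilon_2\right).$$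
   Context: Setting. $D_1,D_2\subset\mathbb R^3$ are bounded domains whose distance is $\kappa=\operatorname{dist}(D_1,D_2)>0$, and $D=D_1\cup D_2$. The static Newtonian operator on $L^2(D)$ is $$\mathcal K_D^{(0)}[u](x)=-\frac1{4\pi}\int_D\frac{u(y)}{|x-y|}\,dy .$$ With respect to $L^2(D)=L^2(D_1)\oplus L^2(D_2)$, let $\mathcal K_{ij}^{(0)}:L^2(D_j)\to L^2(D_i)$ be $\mathcal K_{ij}^{(0)}[u](x)=-\frac1{4\pi}\int_{D_j}\frac{u(y)}{|x-y|}\,dy$ for $x\in D_i$, and write $\mathcal K_D^{(0)}=\mathcal K_{\mathrm{diag}}^{(0)}+\mathcal K_{\mathrm{off}}^{(0)}$ with $$\mathcal K_{\mathrm{diag}}^{(0)}=\begin{pmatrix}\mathcal K_{11}^{(0)}&0\\0&\mathcal K_{22}^{(0)}\end{pmatrix},\qquad \mathcal K_{\mathrm{off}}^{(0)}=\begin{pmatrix}0&\mathcal K_{12}^{(0)}\\\mathcal K_{21}^{(0)}&0\end{pmatrix}.$$ These operators map $L^2(D)$ continuously into $C^0(\overline D)$; in particular eigenfunctions are identified with their continuous representatives on $\overline D$. Quantities. $d_\rho=\operatorname{dist}(\rho,\operatorname{sp}(\mathcal K_{\mathrm{diag}}^{(0)})\setminus\{\rho\})>0$, $\varepsilon_2=\|\mathcal K_{\mathrm{off}}^{(0)}\|_{L^2\to L^2}$, $\varepsilon_\infty=\|\mathcal K_{\mathrm{off}}^{(0)}\|_{L^2\to C^0}$, $C_0=\|\mathcal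 K_{\mathrm{diag}}^{(0)}\|_{L^2\to C^0}$, where $L^2=L^2(D)$ and $C^0=C^0(\overline D)$. Corresponding coupled eigenpair with constant $C_1$. An eigenpair $(\rho_\kappa,\Phi_\kappa)$ of $\mathcal K_D^{(0)}$ with $\|\Phi_\kappa\|_{L^2(D)}=1$ and $\langle\Phi_\kappa,\Phi\rangle_{L^2(D)}\in\mathbb R_{>0}$ such that, with $\delta\phi=\Phi_\kappa-\Phi$ and $\delta\rho=\rho_\kappa-\rho$: $$\|\delta\phi\|_{L^2}\le C_1\frac{\varepsilon_2}{d_\rho},\qquad \|\delta\phi+S_\rho\mathcal K_{\mathrm{off}}^{(0)}\Phi\|_{L^2}\le C_1\frac{\varepsilon_2^2}{d_\rho^2},\qquad |\delta\rho-\langle\mathcal K_{\mathrm{off}}^{(0)}\Phi,\Phi\rangle_{L^2}|\le C_1\frac{\varepsilon_2^2}{d_\rho},$$ where $S_\rho=Q_\rho(\mathcal K_{\mathrm{diag}}^{(0)}-\rho I)^{-1}Q_\rho$, $Q_\rho=I-P_\rho$, and $P_\rho$ is the orthogonal projection onto $\operatorname{span}\{\Phi\}$. *)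

theory Defs
  imports "HOL-Analysis.Analysis"
begin

text \<open>
  An element of \<open>L\<^sup>2(D)\<close> is represented by a complex-valued function on the whole space, of which
  only the values on \<open>D\<close> matter; equality in \<open>L\<^sup>2(D)\<close> is equality almost everywhere on \<open>D\<close>.
  The scalar product is linear in its first argument.
\<close>

type_synonym cfun3 = "real^3 \<Rightarrow> complex"

definition bounded_domain :: "(real^3) set \<Rightarrow> bool" where
  "bounded_domain D \<longleftrightarrow> open D \<and> connected D \<and> D \<noteq> {} \<and> bounded D"

definition L2 :: "(real^3) set \<Rightarrow> cfun3 set" where
  "L2 D = {u \<in> borel_measurable (lebesgue_on D). integrable (lebesgue_on D) (\<lambda>x. (cmod (u x))\<^sup>2)}"

definition ae_eq :: "(real^3) set \<Rightarrow> cfun3 \<Rightarrow> cfun3 \<Rightarrow> bool" where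
  "ae_eq D u v \<longleftrightarrow> (AE x in lebesgue_on D. u x = v x)"

definition l2_inner :: "(real^3) set \<Rightarrow> cfun3 \<Rightarrow> cfun3 \<Rightarrow> complex" where
  "l2_inner D u v = (LINT x|lebesgue_on D. u x * cnj (v x))"

definition l2_norm :: "(real^3) set \<Rightarrow> cfun3 \<Rightarrow> real" where
  "l2_norm D u = sqrt (LINT x|lebesgue_on D. (cmod (u x))\<^sup>2)"

definition c0_norm :: "(real^3) set \<Rightarrow> cfun3 \<Rightarrow> real" where
  "c0_norm D u = (SUP x\<in>closure D. cmod (u x))"

text \<open>
  Operator norms, in the style of \<^const>\<open>onorm\<close> (a quotient with zero denominator is zero).
  Both are applied only to operators that are bounded on \<open>L\<^sup>2(D)\<close>, so that the suprema are finite.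
\<close>

definition onorm_L2_L2 :: "(real^3) set \<Rightarrow> (cfun3 \<Rightarrow> cfun3) \<Rightarrow> real" where
  "onorm_L2_L2 D T = (SUP u\<in>L2 D. l2_norm D (T u) / l2_norm D u)"

definition onorm_L2_C0 :: "(real^3) set \<Rightarrow> (cfun3 \<Rightarrow> cfun3) \<Rightarrow> real" where
  "onorm_L2_C0 D T = (SUP u\<in>L2 D. c0_norm D (T u) / l2_norm D u)"

text \<open>
  The resolvent set: \<open>T - z I\<close> is a bijection of \<open>L\<^sup>2(D)\<close> with bounded inverse.
\<close>

definition l2_resolvent_set :: "(real^3) set \<Rightarrow> (cfun3 \<Rightarrow> cfun3) \<Rightarrow> complex set" where
  "l2_resolvent_set D T =
     {z. (\<forall>u\<in>L2 D. ae_eq D (\<lambda>x. T u x - z * u x) (\<lambda>x. 0) \<longrightarrow> ae_eq D u (\<lambda>x. 0)) \<and>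
         (\<exists>B. \<forall>f\<in>L2 D. \<exists>u\<in>L2 D.
            ae_eq D (\<lambda>x. T u x - z * u x) f \<and> l2_norm D u \<le> B * l2_norm D f)}"

definition l2_spectrum :: "(real^3) set \<Rightarrow> (cfun3 \<Rightarrow> cfun3) \<Rightarrow> complex set" where
  "l2_spectrum D T = - l2_resolvent_set D T"

definition l2_eigenpair :: "(real^3) set \<Rightarrow> (cfun3 \<Rightarrow> cfun3) \<Rightarrow> complex \<Rightarrow> cfun3 \<Rightarrow> bool" where
  "l2_eigenpair D T z u \<longleftrightarrow>
     u \<in> L2 D \<and> \<not> ae_eq D u (\<lambda>x. 0) \<and> ae_eq D (T u) (\<lambda>x. z * u x)"

text \<open>The eigenfunction is taken to be its continuous representative on the closure of \<open>D\<close>.\<close>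

definition c0_eigenpair :: "(real^3) set \<Rightarrow> (cfun3 \<Rightarrow> cfun3) \<Rightarrow> complex \<Rightarrow> cfun3 \<Rightarrow> bool" where
  "c0_eigenpair D T z u \<longleftrightarrow> l2_eigenpair D T z u \<and> continuous_on (closure D) u"

definition simple_isolated_eigenvalue ::
  "(real^3) set \<Rightarrow> (cfun3 \<Rightarrow> cfun3) \<Rightarrow> complex \<Rightarrow> bool" where
  "simple_isolated_eigenvalue D T z \<longleftrightarrow>
     (\<exists>v. l2_eigenpair D T z v \<and>
          (\<forall>u. l2_eigenpair D T z u \<longrightarrow> (\<exists>a. ae_eq D u (\<lambda>x. a * v x)))) \<and>
     z isolated_in l2_spectrum D T"

definition spectral_gap :: "(real^3) set \<Rightarrow> (cfun3 \<Rightarrow> cfun3) \<Rightarrow> complex \<Rightarrow> real" where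
  "spectral_gap D T z = infdist z (l2_spectrum D T - {z})"

text \<open>
  \<open>P\<close> and \<open>Q = I - P\<close> for the line spanned by a normalized \<open>\<Phi>\<close>, and the reduced resolvent
  \<open>Q (T - z I)\<^sup>-\<^sup>1 Q\<close>, in which the inverse is that of \<open>T - z I\<close> on the orthogonal complement of
  \<open>\<Phi>\<close>, the range of \<open>Q\<close>.  The choice operator picks a representative of the solution, which is
  unique up to equality almost everywhere.
\<close>

definition l2_proj :: "(real^3) set \<Rightarrow> cfun3 \<Rightarrow> cfun3 \<Rightarrow> cfun3" where
  "l2_proj D \<Phi> u = (\<lambda>x. l2_inner D u \<Phi> * \<Phi> x)"

definition l2_coproj :: "(real^3) set \<Rightarrow> cfun3 \<Rightarrow> cfun3 \<Rightarrow> cfun3" where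
  "l2_coproj D \<Phi> u = (\<lambda>x. u x - l2_proj D \<Phi> u x)"

definition reduced_resolvent ::
  "(real^3) set \<Rightarrow> (cfun3 \<Rightarrow> cfun3) \<Rightarrow> complex \<Rightarrow> cfun3 \<Rightarrow> cfun3 \<Rightarrow> cfun3" where
  "reduced_resolvent D T z \<Phi> f =
     l2_coproj D \<Phi>
       (SOME w. w \<in> L2 D \<and> l2_inner D w \<Phi> = 0 \<and>
                ae_eq D (\<lambda>x. T w x - z * w x) (l2_coproj D \<Phi> f))"

text \<open>
  The Newtonian potential of a density on \<open>E\<close>.  It is defined and continuous at every point of the
  space, so the operators below take values in \<open>C\<^sup>0\<close> of the closure of \<open>D1 \<union> D2\<close>.
  The closures of \<open>D1\<close> and \<open>D2\<close> are disjoint whenever the domains have positive distance.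
\<close>

definition newton :: "(real^3) set \<Rightarrow> cfun3 \<Rightarrow> cfun3" where
  "newton E u x = - (1 / (4 * complex_of_real pi)) *
     (LINT y|lebesgue_on E. u y / complex_of_real (norm (x - y)))"

definition K_diag :: "(real^3) set \<Rightarrow> (real^3) set \<Rightarrow> cfun3 \<Rightarrow> cfun3" where
  "K_diag D1 D2 u x =
     (if x \<in> closure D1 then newton D1 u x
      else if x \<in> closure D2 then newton D2 u x else 0)"

definition K_off :: "(real^3) set \<Rightarrow> (real^3) set \<Rightarrow> cfun3 \<Rightarrow> cfun3" where
  "K_off D1 D2 u x =
     (if x \<in> closure D1 then newton D2 u x
      else if x \<in> closure D2 then newton D1 u x else 0)"

definition d_gap :: "(real^3) set \<Rightarrow> (real^3) set \<Rightarrow> complex \<Rightarrow> real" where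
  "d_gap D1 D2 \<rho> = spectral_gap (D1 \<union> D2) (K_diag D1 D2) \<rho>"

definition eps2 :: "(real^3) set \<Rightarrow> (real^3) set \<Rightarrow> real" where
  "eps2 D1 D2 = onorm_L2_L2 (D1 \<union> D2) (K_off D1 D2)"

definition eps_inf :: "(real^3) set \<Rightarrow> (real^3) set \<Rightarrow> real" where
  "eps_inf D1 D2 = onorm_L2_C0 (D1 \<union> D2) (K_off D1 D2)"

definition C0_const :: "(real^3) set \<Rightarrow> (real^3) set \<Rightarrow> real" where
  "C0_const D1 D2 = onorm_L2_C0 (D1 \<union> D2) (K_diag D1 D2)"

definition coupled_eigenpair ::
  "(real^3) set \<Rightarrow> (real^3) set \<Rightarrow> real \<Rightarrow> complex \<Rightarrow> cfun3 \<Rightarrow> complex \<Rightarrow> cfun3 \<Rightarrow> bool" where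
  "coupled_eigenpair D1 D2 C1 \<rho> \<Phi> \<rho>\<^sub>\<kappa> \<Phi>\<^sub>\<kappa> \<longleftrightarrow>
     (let D = D1 \<union> D2;
          \<delta>\<phi> = (\<lambda>x. \<Phi>\<^sub>\<kappa> x - \<Phi> x);
          \<delta>\<rho> = \<rho>\<^sub>\<kappa> - \<rho>;
          S = reduced_resolvent D (K_diag D1 D2) \<rho> \<Phi>;
          d = d_gap D1 D2 \<rho>;
          \<epsilon> = eps2 D1 D2
      in c0_eigenpair D (newton D) \<rho>\<^sub>\<kappa> \<Phi>\<^sub>\<kappa> \<and>
         l2_norm D \<Phi>\<^sub>\<kappa> = 1 \<and>
         l2_inner D \<Phi>\<^sub>\<kappa> \<Phi> \<in> \<real> \<and> Re (l2_inner D \<Phi>\<^sub>\<kappa> \<Phi>) > 0 \<and>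
         l2_norm D \<delta>\<phi> \<le> C1 * (\<epsilon> / d) \<and>
         l2_norm D (\<lambda>x. \<delta>\<phi> x + S (K_off D1 D2 \<Phi>) x) \<le> C1 * (\<epsilon>\<^sup>2 / d\<^sup>2) \<and>
         cmod (\<delta>\<rho> - l2_inner D (K_off D1 D2 \<Phi>) \<Phi>) \<le> C1 * (\<epsilon>\<^sup>2 / d))"

end

theory Submission
  imports Defs
begin

text \<open>
  Write \<open>K\<^sub>d\<close> and \<open>K\<^sub>o\<close> for the diagonal and off-diagonal parts of the operator.  The difference of the
  two eigenvalue equations is
  \<open>\<rho>\<^sub>\<kappa> \<delta>\<phi> = K\<^sub>d \<delta>\<phi> + K\<^sub>o \<Phi> + K\<^sub>o \<delta>\<phi> - \<delta>\<rho> \<Phi>\<close>.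
  The operators on the right-hand side are smoothing: each term is controlled pointwise by an operator norm from
  \<open>L\<^sup>2\<close> to \<open>C\<^sup>0\<close> and an \<open>L\<^sup>2\<close> norm that is already known;
  for the last term, \<open>\<Phi> = K\<^sub>d \<Phi> / \<rho>\<close> is at most \<open>C\<^sub>0 / |\<rho>|\<close>.
  Dividing by \<open>|\<rho>\<^sub>\<kappa>| \<ge> |\<rho>| / 2\<close> gives the lemma \<open>eigenfunction_difference_pointwise\<close>.  It remains
  to insert \<open>\<parallel>\<delta>\<phi>\<parallel> \<le> C\<^sub>1 \<epsilon>\<^sub>2 / d\<close> and \<open>|\<delta>\<rho>| \<le> (1 + C\<^sub>1) \<epsilon>\<^sub>2\<close> (lemma \<open>eigenvalue_shift_le\<close>); the constants
  are \<open>c = 1\<close> and \<open>C = 2 (1 + C\<^sub>1)\<close>.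

  The eigenvalue equations hold almost everywhere on \<open>D\<close>, hence so does the pointwise bound, and the
  continuity of \<open>\<Phi>\<close> and \<open>\<Phi>\<^sub>\<kappa>\<close> extends it to the closure (lemma \<open>c0_norm_le_AE\<close>).

  The operator norms are suprema of real numbers and bound anything only if they are finite.  For
  this the kernel \<open>1 / |x - y|\<close> must be square integrable in \<open>y\<close> over a bounded set, uniformly in \<open>x\<close>,
  which follows from a dyadic decomposition around \<open>x\<close> (lemma \<open>nn_integral_inverse_square_ball\<close>).
\<close>

section \<open>The space L2\<close>

lemma Cauchy_Schwarz_integral:
  fixes f g :: "'a \<Rightarrow> complex"
  assumes f [measurable]: "f \<in> borel_measurable M" and g [measurable]: "g \<in> borel_measurable M"
    and f2: "integrable M (\<lambda>x. (cmod (f x))\<^sup>2)" and g2: "integrable M (\<lambda>x. (cmod (g x))\<^sup>2)"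
  shows integrable_mult_L2: "integrable M (\<lambda>x. f x * g x)"
    and norm_integral_mult_le:
      "cmod (LINT x|M. f x * g x) \<le>
        sqrt (LINT x|M. (cmod (f x))\<^sup>2) * sqrt (LINT x|M. (cmod (g x))\<^sup>2)"
proof -
  have amgm: "a * b \<le> a\<^sup>2 + b\<^sup>2" if "0 \<le> a" "0 \<le> b" for a b :: real
    using sum_squares_bound[of a b] mult_nonneg_nonneg[OF that] by linarith
  show int: "integrable M (\<lambda>x. f x * g x)"
    by (rule Bochner_Integration.integrable_bound[OF Bochner_Integration.integrable_add[OF f2 g2]])
       (auto simp: norm_mult intro!: amgm)
  define A where "A = (LINT x|M. (cmod (f x))\<^sup>2)"
  define B where "B = (LINT x|M. (cmod (g x))\<^sup>2)"
  define X where "X = (LINT x|M. cmod (f x) * cmod (g x))"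
  have intX: "integrable M (\<lambda>x. cmod (f x) * cmod (g x))"
    using integrable_norm[OF int] by (simp add: norm_mult)
  have nonneg: "0 \<le> A" "0 \<le> B" "0 \<le> X"
    unfolding A_def B_def X_def by auto
  have quad: "0 \<le> t\<^sup>2 * A - 2 * t * X + B" for t
  proof -
    have "0 \<le> (LINT x|M. (t * cmod (f x) - cmod (g x))\<^sup>2)"
      by (rule integral_nonneg_AE) auto
    also have "\<dots> = (LINT x|M. t\<^sup>2 * (cmod (f x))\<^sup>2 - 2 * t * (cmod (f x) * cmod (g x))
        + (cmod (g x))\<^sup>2)"
      by (rule Bochner_Integration.integral_cong) (auto simp: power2_eq_square algebra_simps)
    also have "\<dots> = t\<^sup>2 * A - 2 * t * X + B"
      unfolding A_def B_def X_def using f2 g2 intX by simp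
    finally show ?thesis .
  qed
  \<comment> \<open>This says that the discriminant of the nonnegative polynomial in \<open>t\<close> is not positive.\<close>
  have "X\<^sup>2 \<le> A * B"
  proof (cases "A = 0")
    case True
    have "X = 0"
    proof (rule ccontr)
      assume "X \<noteq> 0"
      \<comment> \<open>A nonconstant affine function of \<open>t\<close> takes negative values; here it takes the value \<open>-1\<close>.\<close>
      then show False
        using quad[of "(B + 1) / (2 * X)"] True by simp
    qed
    then show ?thesis
      using nonneg by simp
  next
    case False
    have "0 \<le> A * ((X / A)\<^sup>2 * A - 2 * (X / A) * X + B)"
      using quad[of "X / A"] nonneg by simp
    also have "\<dots> = A * B - X\<^sup>2"
      using False by (simp add: field_simps power2_eq_square)
    finally show ?thesis
      by simp
  qed
  then have "X \<le> sqrt A * sqrt B"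
    by (metis real_le_rsqrt real_sqrt_mult)
  moreover have "cmod (LINT x|M. f x * g x) \<le> X"
    unfolding X_def using integral_norm_bound[of M "\<lambda>x. f x * g x"] by (simp add: norm_mult)
  ultimately show "cmod (LINT x|M. f x * g x) \<le>
        sqrt (LINT x|M. (cmod (f x))\<^sup>2) * sqrt (LINT x|M. (cmod (g x))\<^sup>2)"
    unfolding A_def B_def by linarith
qed

lemma l2_norm_nonneg: "0 \<le> l2_norm D u"
  by (simp add: l2_norm_def)

lemma l2_inner_le:
  assumes "u \<in> L2 D" "v \<in> L2 D"
  shows "cmod (l2_inner D u v) \<le> l2_norm D u * l2_norm D v"
proof -
  have "(\<lambda>x. cnj (v x)) \<in> borel_measurable (lebesgue_on D)"
    using assms(2) measurable_compose[OF _ borel_measurable_continuous_onI[of cnj]]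
    by (auto simp: L2_def continuous_on_cnj)
  then show ?thesis
    using norm_integral_mult_le[of u "lebesgue_on D" "\<lambda>x. cnj (v x)"] assms
    by (simp add: L2_def l2_inner_def l2_norm_def)
qed

lemma L2_diff:
  assumes "u \<in> L2 D" "v \<in> L2 D"
  shows "(\<lambda>x. u x - v x) \<in> L2 D"
proof -
  have [measurable]: "u \<in> borel_measurable (lebesgue_on D)" "v \<in> borel_measurable (lebesgue_on D)"
    using assms by (auto simp: L2_def)
  have "integrable (lebesgue_on D) (\<lambda>x. 2 * (cmod (u x))\<^sup>2 + 2 * (cmod (v x))\<^sup>2)"
    using assms by (auto simp: L2_def)
  then have "integrable (lebesgue_on D) (\<lambda>x. (cmod (u x - v x))\<^sup>2)"
  proof (rule Bochner_Integration.integrable_bound)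
    have "(cmod (u x - v x))\<^sup>2 \<le> 2 * (cmod (u x))\<^sup>2 + 2 * (cmod (v x))\<^sup>2" for x
    proof -
      have "(cmod (u x - v x))\<^sup>2 \<le> (cmod (u x) + cmod (v x))\<^sup>2"
        by (intro power_mono norm_triangle_ineq4) auto
      also have "\<dots> \<le> 2 * (cmod (u x))\<^sup>2 + 2 * (cmod (v x))\<^sup>2"
        using sum_squares_bound[of "cmod (u x)" "cmod (v x)"]
        by (simp add: power2_sum)
      finally show ?thesis .
    qed
    then show "AE x in lebesgue_on D. norm ((cmod (u x - v x))\<^sup>2)
        \<le> norm (2 * (cmod (u x))\<^sup>2 + 2 * (cmod (v x))\<^sup>2)"
      by simp
  qed auto
  then show ?thesis
    by (simp add: L2_def)
qed

lemma L2_subset: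
  assumes "u \<in> L2 D" "E \<subseteq> D" "E \<in> sets lebesgue" "D \<in> sets lebesgue"
  shows "u \<in> L2 E" and "l2_norm E u \<le> l2_norm D u"
proof -
  have D: "integrable lebesgue (\<lambda>x. indicator D x *\<^sub>R (cmod (u x))\<^sup>2)"
    using assms by (simp add: L2_def integrable_restrict_space)
  have eq: "indicator E x *\<^sub>R (indicator D x *\<^sub>R (cmod (u x))\<^sup>2) = indicator E x *\<^sub>R (cmod (u x))\<^sup>2"
    for x
    using \<open>E \<subseteq> D\<close> by (auto simp: indicator_def)
  have E: "integrable lebesgue (\<lambda>x. indicator E x *\<^sub>R (cmod (u x))\<^sup>2)"
    using integrable_mult_indicator[OF assms(3) D] by (simp only: eq)
  have "u \<in> borel_measurable (lebesgue_on E)"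
    using assms(1,2) by (auto simp: L2_def intro: measurable_restrict_mono)
  then show "u \<in> L2 E"
    using E assms(3) by (simp add: L2_def integrable_restrict_space)
  have "(LINT x|lebesgue. indicator E x *\<^sub>R (cmod (u x))\<^sup>2)
      \<le> (LINT x|lebesgue. indicator D x *\<^sub>R (cmod (u x))\<^sup>2)"
    using \<open>E \<subseteq> D\<close> by (intro integral_mono[OF E D]) (auto simp: indicator_def)
  then show "l2_norm E u \<le> l2_norm D u"
    using assms(3,4) by (simp add: l2_norm_def integral_restrict_space)
qed

lemma L2_bounded:
  assumes D: "D \<in> lmeasurable" and u: "u \<in> borel_measurable (lebesgue_on D)"
    and le: "\<And>x. x \<in> D \<Longrightarrow> cmod (u x) \<le> B"
  shows "u \<in> L2 D" and "0 \<le> B \<Longrightarrow> l2_norm D u \<le> B * sqrt (measure lebesgue D)"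
proof -
  interpret finite_measure "lebesgue_on D"
    using D by (rule finite_measure_lebesgue_on)
  note [measurable] = u
  have sq: "(cmod (u x))\<^sup>2 \<le> B\<^sup>2" if "x \<in> D" for x
    using le[OF that] by (intro power_mono) auto
  have int: "integrable (lebesgue_on D) (\<lambda>x. (cmod (u x))\<^sup>2)"
    by (rule integrable_const_bound[where B = "B\<^sup>2"]) (auto intro!: AE_I2 sq)
  then show "u \<in> L2 D"
    using u by (simp add: L2_def)
  assume "0 \<le> B"
  have "(LINT x|lebesgue_on D. (cmod (u x))\<^sup>2) \<le> (LINT x|lebesgue_on D. B\<^sup>2)"
    using sq by (intro integral_mono[OF int]) auto
  also have "\<dots> = B\<^sup>2 * measure lebesgue D"
    using D by (simp add: measure_restrict_space fmeasurableD)
  finally have "l2_norm D u \<le> sqrt (B\<^sup>2 * measure lebesgue D)"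
    unfolding l2_norm_def by (rule real_sqrt_le_mono)
  then show "l2_norm D u \<le> B * sqrt (measure lebesgue D)"
    using \<open>0 \<le> B\<close> by (simp add: real_sqrt_mult)
qed

section \<open>Operator norms and the supremum norm\<close>

text \<open>
  The supremum of a set of reals that is unbounded above is arbitrary; the a priori bound \<open>B\<close>
  excludes this case.
\<close>

lemma onorm_L2_C0_bound:
  assumes "u \<in> L2 D" "x \<in> closure D"
    and bound: "\<And>u x. u \<in> L2 D \<Longrightarrow> x \<in> closure D \<Longrightarrow> cmod (T u x) \<le> B * l2_norm D u"
    and "0 \<le> B"
  shows "cmod (T u x) \<le> onorm_L2_C0 D T * l2_norm D u"
proof (cases "l2_norm D u = 0")
  case True
  then show ?thesis
    using bound[OF assms(1,2)] by simp
next
  case False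
  then have pos: "0 < l2_norm D u"
    using l2_norm_nonneg[of D u] by linarith
  have quot: "c0_norm D (T v) / l2_norm D v \<le> B" if "v \<in> L2 D" for v
  proof (cases "l2_norm D v = 0")
    case False
    have "c0_norm D (T v) \<le> B * l2_norm D v"
      unfolding c0_norm_def using assms(2) bound[OF that] by (intro cSUP_least) auto
    then show ?thesis
      using False l2_norm_nonneg[of D v] by (simp add: divide_le_eq)
  qed (use \<open>0 \<le> B\<close> in simp)
  have "cmod (T u x) \<le> c0_norm D (T u)"
    unfolding c0_norm_def
    using bound[OF assms(1)] by (intro cSUP_upper assms(2) bdd_aboveI2) auto
  then have "cmod (T u x) / l2_norm D u \<le> c0_norm D (T u) / l2_norm D u"
    using pos by (simp add: divide_right_mono)
  also have "\<dots> \<le> onorm_L2_C0 D T"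
    unfolding onorm_L2_C0_def using quot by (intro cSUP_upper assms(1) bdd_aboveI2) auto
  finally show ?thesis
    using pos by (simp add: divide_le_eq)
qed

lemma onorm_L2_L2_bound:
  assumes "u \<in> L2 D"
    and bound: "\<And>u. u \<in> L2 D \<Longrightarrow> l2_norm D (T u) \<le> B * l2_norm D u"
    and "0 \<le> B"
  shows "l2_norm D (T u) \<le> onorm_L2_L2 D T * l2_norm D u"
proof (cases "l2_norm D u = 0")
  case True
  then show ?thesis
    using bound[OF assms(1)] by simp
next
  case False
  then have pos: "0 < l2_norm D u"
    using l2_norm_nonneg[of D u] by linarith
  have quot: "l2_norm D (T v) / l2_norm D v \<le> B" if "v \<in> L2 D" for v
    using bound[OF that] l2_norm_nonneg[of D v] \<open>0 \<le> B\<close>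
    by (cases "l2_norm D v = 0") (auto simp: divide_le_eq)
  have "l2_norm D (T u) / l2_norm D u \<le> onorm_L2_L2 D T"
    unfolding onorm_L2_L2_def using quot by (intro cSUP_upper assms(1) bdd_aboveI2) auto
  then show ?thesis
    using pos by (simp add: divide_le_eq)
qed

text \<open>
  A nonempty open set is not null, so a bound that holds almost everywhere on \<open>D\<close> holds on a dense
  subset of \<open>D\<close>, and continuity carries it to the closure.
\<close>

lemma c0_norm_le_AE:
  assumes "open D" "D \<noteq> {}" and cont: "continuous_on (closure D) f"
    and ae: "AE x in lebesgue_on D. cmod (f x) \<le> B"
  shows "c0_norm D f \<le> B"
  unfolding c0_norm_def
proof (rule cSUP_least)
  show "closure D \<noteq> {}"
    using assms(2) by simp
  fix x assume x: "x \<in> closure D"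
  show "cmod (f x) \<le> B"
  proof (rule ccontr)
    assume "\<not> cmod (f x) \<le> B"
    then have "\<exists>d>0. \<forall>y\<in>closure D. dist y x < d \<longrightarrow> dist (f y) (f x) < cmod (f x) - B"
      using cont x by (auto simp: continuous_on_iff)
    then obtain d where d: "d > 0"
      "\<And>y. y \<in> closure D \<Longrightarrow> dist y x < d \<Longrightarrow> dist (f y) (f x) < cmod (f x) - B"
      by blast
    define U where "U = D \<inter> ball x d"
    have U: "open U" "U \<noteq> {}"
      using \<open>open D\<close> x d(1) by (auto simp: U_def closure_approachable dist_commute disjoint_iff)
    have large: "B < cmod (f y)" if "y \<in> U" for y
    proof -
      have "dist (f y) (f x) < cmod (f x) - B"
        using that closure_subset[of D] by (intro d(2)) (auto simp: U_def dist_commute)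
      then show ?thesis
        using norm_triangle_ineq2[of "f x" "f y"] by (simp add: dist_norm norm_minus_commute)
    qed
    have "AE y in lebesgue. y \<in> D \<longrightarrow> cmod (f y) \<le> B"
      using ae \<open>open D\<close> by (subst (asm) AE_restrict_space_iff) auto
    then have "AE y in lebesgue. y \<notin> U"
      by eventually_elim (use large in \<open>force simp: U_def\<close>)
    then have "U \<in> null_sets lebesgue"
      using U(1) by (subst AE_iff_null_sets) auto
    then show False
      using open_not_negligible[OF U] by (simp add: negligible_iff_null_sets)
  qed
qed

section \<open>The Newtonian potential\<close>

text \<open>
  On the shell between the radii \<open>R / 2^(k+1)\<close> and \<open>R / 2^k\<close> the square of the kernel is at most
  \<open>4^(k+1) / R\<^sup>2\<close>, while the volume is of order \<open>R\<^sup>3 / 8^k\<close>.  The shells contribute a convergent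
  geometric series, which does not depend on the centre.
\<close>

lemma nn_integral_inverse_square_ball:
  fixes x :: "real^3"
  assumes "0 < R"
  shows "(\<integral>\<^sup>+y. ennreal (1 / (norm (x - y))\<^sup>2) * indicator (ball x R) y \<partial>lebesgue)
    \<le> ennreal (8 * unit_ball_vol 3 * R)"
proof -
  define r where "r k = R / 2 ^ k" for k :: nat
  define a where "a k = 4 ^ Suc k / R\<^sup>2" for k :: nat
  have shell: "ennreal (1 / (norm (x - y))\<^sup>2) * indicator (ball x R) y
      \<le> (\<Sum>k. ennreal (a k) * indicator (ball x (r k)) y)" for y
  proof (cases "y \<in> ball x R \<and> y \<noteq> x")
    case False
    then show ?thesis
      by auto
  next
    case True
    define s where "s = norm (x - y)"
    have s: "0 < s" "s < R"
      using True by (auto simp: s_def dist_norm)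
    have lim: "r \<longlonglongrightarrow> 0"
      unfolding r_def by (rule LIMSEQ_divide_realpow_zero) simp
    then have "eventually (\<lambda>k. r k < s) sequentially"
      using s(1) by (rule order_tendstoD)
    then obtain m where "r m \<le> s"
      by (metis eventually_sequentially less_imp_le order_refl)
    \<comment> \<open>The shell that contains \<open>y\<close> lies just outside the largest ball of radius \<open>r k \<le> s\<close>.\<close>
    define k where "k = (LEAST k. r k \<le> s)"
    have k: "r k \<le> s"
      unfolding k_def using \<open>r m \<le> s\<close> by (rule LeastI)
    then have "k \<noteq> 0"
      using s(2) by (intro notI) (simp add: r_def)
    then obtain j where j: "k = Suc j"
      by (cases k) auto
    have "\<not> r j \<le> s"
      using not_less_Least[of j "\<lambda>k. r k \<le> s"] j unfolding k_def by simp
    then have y: "y \<in> ball x (r j)"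
      by (simp add: s_def dist_norm)
    have "(r k)\<^sup>2 \<le> s\<^sup>2"
      using k \<open>0 < R\<close> by (intro power_mono) (auto simp: r_def)
    then have "1 / s\<^sup>2 \<le> 1 / (r k)\<^sup>2"
      using \<open>0 < R\<close> s by (intro divide_left_mono) (auto simp: r_def)
    also have "\<dots> = a j"
    proof -
      have "(2::real) ^ k * 2 ^ k = 4 ^ k"
        by (simp flip: power_mult_distrib)
      then show ?thesis
        using \<open>0 < R\<close> by (simp add: r_def a_def j power2_eq_square field_simps)
    qed
    finally have "ennreal (1 / s\<^sup>2) \<le> ennreal (a j) * indicator (ball x (r j)) y"
      using y by (simp add: ennreal_leI)
    also have "\<dots> \<le> (\<Sum>k. ennreal (a k) * indicator (ball x (r k)) y)"
    proof -
      define f where "f k = ennreal (a k) * indicator (ball x (r k)) y" for k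
      have "f j \<le> (\<Sum>k. f k)"
        using sum_le_suminf[of f "{j}"] by simp
      then show ?thesis
        unfolding f_def .
    qed
    finally show ?thesis
      using True by (simp add: s_def)
  qed
  have vol: "emeasure lborel (ball x (r k)) = ennreal (unit_ball_vol 3 * r k ^ 3)" for k
    using emeasure_ball[of "r k" x] \<open>0 < R\<close> by (simp add: r_def)
  have mass: "ennreal (a k) * emeasure lborel (ball x (r k))
      = ennreal (4 * unit_ball_vol 3 * R * (1 / 2) ^ k)" for k
  proof -
    have "(4::real) ^ k = 2 ^ k * 2 ^ k"
      by (simp flip: power_mult_distrib)
    then have "a k * (unit_ball_vol 3 * r k ^ 3) = 4 * unit_ball_vol 3 * R * (1 / 2) ^ k"
      using \<open>0 < R\<close>
      by (simp add: a_def r_def power2_eq_square power3_eq_cube power_one_over divide_simps)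
    moreover have "0 \<le> a k"
      by (simp add: a_def)
    ultimately show ?thesis
      unfolding vol by (simp only: flip: ennreal_mult')
  qed
  have "(\<integral>\<^sup>+y. ennreal (1 / (norm (x - y))\<^sup>2) * indicator (ball x R) y \<partial>lebesgue)
      \<le> (\<integral>\<^sup>+y. (\<Sum>k. ennreal (a k) * indicator (ball x (r k)) y) \<partial>lebesgue)"
    by (rule nn_integral_mono) (rule shell)
  also have "\<dots> = (\<Sum>k. \<integral>\<^sup>+y. ennreal (a k) * indicator (ball x (r k)) y \<partial>lebesgue)"
    by (intro nn_integral_suminf borel_measurable_times_ennreal borel_measurable_indicator) auto
  also have "\<dots> = (\<Sum>k. ennreal (4 * unit_ball_vol 3 * R * (1 / 2) ^ k))"
    by (simp add: nn_integral_cmult_indicator mass)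
  also have "\<dots> = ennreal (8 * unit_ball_vol 3 * R)"
  proof (rule suminf_ennreal_eq)
    show "(\<lambda>k. 4 * unit_ball_vol 3 * R * (1 / 2) ^ k) sums (8 * unit_ball_vol 3 * R)"
      using sums_mult[OF geometric_sums[of "1 / 2 :: real"], of "4 * unit_ball_vol 3 * R"]
      by (simp add: mult.assoc)
  qed (use \<open>0 < R\<close> in simp)
  finally show ?thesis .
qed

lemma kernel_L2:
  fixes x :: "real^3"
  assumes "0 < R" and E: "E \<subseteq> ball x R" "E \<in> sets lebesgue"
  shows "(\<lambda>y. 1 / complex_of_real (norm (x - y))) \<in> L2 E"
    and "(l2_norm E (\<lambda>y. 1 / complex_of_real (norm (x - y))))\<^sup>2 \<le> 8 * unit_ball_vol 3 * R"
proof -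
  have id [measurable]: "(\<lambda>y. y) \<in> borel_measurable (lebesgue_on E)"
    by (simp add: measurable_completion measurable_restrict_space1)
  have eq: "(cmod (1 / complex_of_real (norm (x - y))))\<^sup>2 = 1 / (norm (x - y))\<^sup>2" for y
    by (simp add: norm_divide power_divide)
  have "(\<integral>\<^sup>+y. ennreal (1 / (norm (x - y))\<^sup>2) \<partial>lebesgue_on E)
      = (\<integral>\<^sup>+y. ennreal (1 / (norm (x - y))\<^sup>2) * indicator E y \<partial>lebesgue)"
    using E(2) by (simp add: nn_integral_restrict_space)
  also have "\<dots> \<le> (\<integral>\<^sup>+y. ennreal (1 / (norm (x - y))\<^sup>2) * indicator (ball x R) y \<partial>lebesgue)"
    using E(1) by (intro nn_integral_mono) (auto simp: indicator_def)
  also have "\<dots> \<le> ennreal (8 * unit_ball_vol 3 * R)"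
    using nn_integral_inverse_square_ball[OF \<open>0 < R\<close>] .
  finally have nn: "(\<integral>\<^sup>+y. ennreal (1 / (norm (x - y))\<^sup>2) \<partial>lebesgue_on E)
      \<le> ennreal (8 * unit_ball_vol 3 * R)" .
  have int: "integrable (lebesgue_on E) (\<lambda>y. 1 / (norm (x - y))\<^sup>2)"
    using nn by (intro integrableI_bounded) (auto simp: le_less_trans)
  then show "(\<lambda>y. 1 / complex_of_real (norm (x - y))) \<in> L2 E"
    unfolding L2_def mem_Collect_eq eq by auto
  have "(LINT y|lebesgue_on E. 1 / (norm (x - y))\<^sup>2) \<le> 8 * unit_ball_vol 3 * R"
    using nn int \<open>0 < R\<close> by (simp add: nn_integral_eq_integral)
  then show "(l2_norm E (\<lambda>y. 1 / complex_of_real (norm (x - y))))\<^sup>2 \<le> 8 * unit_ball_vol 3 * R"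
    by (simp add: l2_norm_def eq)
qed

lemma newton_integrable:
  assumes "bounded E" "E \<in> sets lebesgue" "u \<in> L2 E"
  shows "integrable (lebesgue_on E) (\<lambda>y. u y / complex_of_real (norm (x - y)))"
proof -
  obtain R where "0 < R" "E \<subseteq> ball x R"
    using bounded_subset_ballD[OF assms(1)] by blast
  then have "(\<lambda>y. 1 / complex_of_real (norm (x - y))) \<in> L2 E"
    using assms(2) by (intro kernel_L2)
  then show ?thesis
    using integrable_mult_L2[of u "lebesgue_on E" "\<lambda>y. 1 / complex_of_real (norm (x - y))"] assms(3)
    by (simp add: L2_def)
qed

text \<open>
  The bound is uniform in the point of evaluation because a single radius serves for all of them.
\<close>

lemma newton_bounded:
  assumes D: "bounded D" "D \<in> sets lebesgue" and E: "E \<subseteq> D" "E \<in> sets lebesgue"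
  obtains B where "0 \<le> B"
    "\<And>u x. u \<in> L2 D \<Longrightarrow> x \<in> closure D \<Longrightarrow> cmod (newton E u x) \<le> B * l2_norm D u"
proof -
  obtain r where r: "0 < r" "closure D \<subseteq> ball 0 r"
    using bounded_subset_ballD[of "closure D" 0] D(1) by auto
  define B where "B = sqrt (8 * unit_ball_vol 3 * (2 * r)) / (4 * pi)"
  have "cmod (newton E u x) \<le> B * l2_norm D u" if u: "u \<in> L2 D" and x: "x \<in> closure D" for u x
  proof -
    have "E \<subseteq> ball x (2 * r)"
    proof
      fix y assume "y \<in> E"
      have "E \<subseteq> ball 0 r"
        by (rule order_trans[OF E(1) order_trans[OF closure_subset r(2)]])
      then have "y \<in> ball 0 r" "x \<in> ball 0 r"
        using \<open>y \<in> E\<close> r(2) x by (simp_all only: subset_iff)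
      then show "y \<in> ball x (2 * r)"
        using norm_triangle_ineq4[of x y] by (simp add: dist_norm)
    qed
    note k = kernel_L2[OF _ this E(2)]
    have uE: "u \<in> L2 E" "l2_norm E u \<le> l2_norm D u"
      using L2_subset[OF u E D(2)] by auto
    have "cmod (LINT y|lebesgue_on E. u y * (1 / complex_of_real (norm (x - y))))
        \<le> l2_norm E u * l2_norm E (\<lambda>y. 1 / complex_of_real (norm (x - y)))"
      unfolding l2_norm_def
      using uE(1) k(1) r(1) by (intro norm_integral_mult_le) (auto simp: L2_def)
    also have "\<dots> \<le> l2_norm D u * sqrt (8 * unit_ball_vol 3 * (2 * r))"
      using uE(2) k(2) r(1) by (intro mult_mono real_le_rsqrt) (auto simp: l2_norm_nonneg)
    finally show ?thesis
      by (simp add: newton_def B_def norm_mult norm_divide field_simps)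
  qed
  moreover have "0 \<le> B"
    using r by (simp add: B_def)
  ultimately show ?thesis
    using that by blast
qed

lemma newton_measurable:
  assumes u: "u \<in> borel_measurable (lebesgue_on E)" and E: "E \<in> lmeasurable"
  shows "newton E u \<in> borel_measurable (lebesgue_on D)"
proof -
  interpret finite_measure "lebesgue_on E"
    using E by (rule finite_measure_lebesgue_on)
  note [measurable] = u
  have [measurable]: "(\<lambda>y. y) \<in> borel_measurable (lebesgue_on A)" for A :: "(real^3) set"
    by (simp add: measurable_completion measurable_restrict_space1)
  have [measurable]: "fst \<in> borel_measurable (lebesgue_on D \<Otimes>\<^sub>M lebesgue_on E)"
    using measurable_compose[OF measurable_fst, of "\<lambda>y. y"] by simp
  have [measurable]: "snd \<in> borel_measurable (lebesgue_on D \<Otimes>\<^sub>M lebesgue_on E)"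
    using measurable_compose[OF measurable_snd, of "\<lambda>y. y"] by simp
  have "(\<lambda>x. LINT y|lebesgue_on E. u y / complex_of_real (norm (x - y)))
      \<in> borel_measurable (lebesgue_on D)"
    by (rule borel_measurable_lebesgue_integral) (simp add: case_prod_beta')
  then show ?thesis
    unfolding newton_def by (intro borel_measurable_times) auto
qed

lemma newton_diff:
  assumes "bounded E" "E \<in> sets lebesgue" "u \<in> L2 E" "v \<in> L2 E"
  shows "newton E (\<lambda>y. u y - v y) x = newton E u x - newton E v x"
  using newton_integrable[OF assms(1-3)] newton_integrable[OF assms(1,2,4)]
  by (simp add: newton_def diff_divide_distrib right_diff_distrib)

lemma newton_Un:
  assumes "bounded E" "E \<in> sets lebesgue" "bounded F" "F \<in> sets lebesgue" "E \<inter> F = {}"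
    and "u \<in> L2 E" "u \<in> L2 F"
  shows "newton (E \<union> F) u x = newton E u x + newton F u x"
proof -
  let ?g = "\<lambda>y. u y / complex_of_real (norm (x - y))"
  have eq: "(LINT y|lebesgue_on A. ?g y) = set_lebesgue_integral lebesgue A ?g"
    if "A \<in> sets lebesgue" for A
    using that by (simp add: integral_restrict_space set_lebesgue_integral_def)
  have "set_integrable lebesgue A ?g" if "bounded A" "A \<in> sets lebesgue" "u \<in> L2 A" for A
    using newton_integrable[OF that] that(2)
    by (simp add: set_integrable_def integrable_restrict_space)
  then have "(LINT y|lebesgue_on (E \<union> F). ?g y)
      = (LINT y|lebesgue_on E. ?g y) + (LINT y|lebesgue_on F. ?g y)"
    using assms by (simp add: eq set_integral_Un)
  then show ?thesis
    unfolding newton_def by (simp only: distrib_left)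
qed

section \<open>Two domains at a positive distance\<close>

locale two_domains =
  fixes D1 D2 :: "(real^3) set"
  assumes dom: "bounded_domain D1" "bounded_domain D2" and dist_pos: "setdist D1 D2 > 0"
begin

abbreviation D where "D \<equiv> D1 \<union> D2"

lemma domain_facts:
  shows "bounded D1" "bounded D2" "bounded D" "open D1" "open D2" "open D" "D \<noteq> {}"
    "D1 \<in> sets lebesgue" "D2 \<in> sets lebesgue" "D \<in> sets lebesgue"
    "D1 \<in> lmeasurable" "D2 \<in> lmeasurable" "D \<in> lmeasurable"
  using dom by (auto simp: bounded_domain_def intro!: lmeasurable_open)

lemma closure_disjoint: "closure D1 \<inter> closure D2 = {}"
  using dist_pos setdist_eq_0I[of _ "closure D1" "closure D2"] by auto

lemma L2_parts:
  assumes "u \<in> L2 D"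
  shows "u \<in> L2 D1" "u \<in> L2 D2"
  using L2_subset(1)[OF assms] domain_facts by auto

lemma K_diff:
  assumes "u \<in> L2 D" "v \<in> L2 D"
  shows "K_diag D1 D2 (\<lambda>y. u y - v y) x = K_diag D1 D2 u x - K_diag D1 D2 v x"
    and "K_off D1 D2 (\<lambda>y. u y - v y) x = K_off D1 D2 u x - K_off D1 D2 v x"
  using assms[THEN L2_parts(1)] assms[THEN L2_parts(2)] domain_facts
  by (auto simp: K_diag_def K_off_def newton_diff)

lemma newton_eq_K:
  assumes "u \<in> L2 D" "x \<in> D"
  shows "newton D u x = K_diag D1 D2 u x + K_off D1 D2 u x"
proof -
  have "D1 \<inter> D2 = {}"
    using closure_disjoint closure_subset by blast
  then have "newton D u x = newton D1 u x + newton D2 u x"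
    using L2_parts[OF assms(1)] domain_facts by (intro newton_Un)
  then show ?thesis
    using assms(2) closure_subset by (auto simp: K_diag_def K_off_def)
qed

lemma K_bounded:
  obtains B where "0 \<le> B"
    "\<And>u x. u \<in> L2 D \<Longrightarrow> x \<in> closure D \<Longrightarrow> cmod (K_diag D1 D2 u x) \<le> B * l2_norm D u"
    "\<And>u x. u \<in> L2 D \<Longrightarrow> x \<in> closure D \<Longrightarrow> cmod (K_off D1 D2 u x) \<le> B * l2_norm D u"
proof -
  obtain B1 where B1: "0 \<le> B1"
    "\<And>u x. u \<in> L2 D \<Longrightarrow> x \<in> closure D \<Longrightarrow> cmod (newton D1 u x) \<le> B1 * l2_norm D u"
    using newton_bounded[of D D1] domain_facts by auto
  obtain B2 where B2: "0 \<le> B2"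
    "\<And>u x. u \<in> L2 D \<Longrightarrow> x \<in> closure D \<Longrightarrow> cmod (newton D2 u x) \<le> B2 * l2_norm D u"
    using newton_bounded[of D D2] domain_facts by auto
  have "cmod (newton D1 u x) \<le> (B1 + B2) * l2_norm D u"
    "cmod (newton D2 u x) \<le> (B1 + B2) * l2_norm D u" if "u \<in> L2 D" "x \<in> closure D" for u x
  proof -
    have "0 \<le> B1 * l2_norm D u" "0 \<le> B2 * l2_norm D u"
      using B1(1) B2(1) by (simp_all add: l2_norm_nonneg)
    then show "cmod (newton D1 u x) \<le> (B1 + B2) * l2_norm D u"
      "cmod (newton D2 u x) \<le> (B1 + B2) * l2_norm D u"
      using B1(2)[OF that] B2(2)[OF that] by (simp_all add: distrib_right)
  qed
  then show ?thesis
    using B1(1) B2(1) by (intro that[of "B1 + B2"]) (auto simp: K_diag_def K_off_def)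
qed

lemma K_off_L2:
  obtains B where "0 \<le> B"
    "\<And>u. u \<in> L2 D \<Longrightarrow> K_off D1 D2 u \<in> L2 D"
    "\<And>u. u \<in> L2 D \<Longrightarrow> l2_norm D (K_off D1 D2 u) \<le> B * l2_norm D u"
proof -
  obtain B where B: "0 \<le> B"
    "\<And>u x. u \<in> L2 D \<Longrightarrow> x \<in> closure D \<Longrightarrow> cmod (K_off D1 D2 u x) \<le> B * l2_norm D u"
    using K_bounded by metis
  have meas: "K_off D1 D2 u \<in> borel_measurable (lebesgue_on D)" if "u \<in> L2 D" for u
  proof -
    have cl: "{x \<in> space (lebesgue_on D). x \<in> closure A} \<in> sets (lebesgue_on D)" for A
    proof -
      have "{x \<in> space (lebesgue_on D). x \<in> closure A} = D \<inter> closure A"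
        by auto
      then show ?thesis
        using domain_facts(10) by (auto simp: sets_restrict_space)
    qed
    have "newton D1 u \<in> borel_measurable (lebesgue_on D)"
      "newton D2 u \<in> borel_measurable (lebesgue_on D)"
      using L2_parts[OF that] domain_facts by (auto simp: L2_def intro!: newton_measurable)
    then show ?thesis
      unfolding K_off_def by (intro measurable_If cl) auto
  qed
  have le: "cmod (K_off D1 D2 u x) \<le> B * l2_norm D u" if "u \<in> L2 D" "x \<in> D" for u x
    using B(2) that closure_subset by blast
  show ?thesis
  proof
    show "0 \<le> B * sqrt (measure lebesgue D)"
      using B(1) by simp
    fix u assume u: "u \<in> L2 D"
    show "K_off D1 D2 u \<in> L2 D"
      using L2_bounded(1)[OF domain_facts(13) meas[OF u] le[OF u]] by blast
    show "l2_norm D (K_off D1 D2 u) \<le> B * sqrt (measure lebesgue D) * l2_norm D u"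
      using L2_bounded(2)[OF domain_facts(13) meas[OF u] le[OF u]] B(1)
      by (simp add: l2_norm_nonneg mult_ac)
  qed
qed

lemma C0_const_bound:
  assumes "u \<in> L2 D" "x \<in> closure D"
  shows "cmod (K_diag D1 D2 u x) \<le> C0_const D1 D2 * l2_norm D u"
  using K_bounded onorm_L2_C0_bound[OF assms, of "K_diag D1 D2"] unfolding C0_const_def by metis

lemma eps_inf_bound:
  assumes "u \<in> L2 D" "x \<in> closure D"
  shows "cmod (K_off D1 D2 u x) \<le> eps_inf D1 D2 * l2_norm D u"
  using K_bounded onorm_L2_C0_bound[OF assms, of "K_off D1 D2"] unfolding eps_inf_def by metis

lemma eps2_bound:
  assumes "u \<in> L2 D"
  shows "l2_norm D (K_off D1 D2 u) \<le> eps2 D1 D2 * l2_norm D u"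
  using K_off_L2 onorm_L2_L2_bound[OF assms, of "K_off D1 D2"] unfolding eps2_def by metis

text \<open>
  The first-order term of the eigenvalue shift is at most \<open>\<epsilon>\<^sub>2\<close> by the Cauchy-Schwarz inequality, and
  \<open>\<epsilon>\<^sub>2 \<le> d\<close> makes the second-order remainder a multiple of \<open>\<epsilon>\<^sub>2\<close> as well.
\<close>

lemma eigenvalue_shift_le:
  assumes \<Phi>: "\<Phi> \<in> L2 D" "l2_norm D \<Phi> = 1"
    and "0 < d" "eps2 D1 D2 \<le> d" "0 \<le> C1"
    and rem: "cmod (\<delta> - l2_inner D (K_off D1 D2 \<Phi>) \<Phi>) \<le> C1 * ((eps2 D1 D2)\<^sup>2 / d)"
  shows "cmod \<delta> \<le> (1 + C1) * eps2 D1 D2"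
proof -
  have eps: "0 \<le> eps2 D1 D2"
    using eps2_bound[OF \<Phi>(1)] l2_norm_nonneg[of D "K_off D1 D2 \<Phi>"] \<Phi>(2) by simp
  have "K_off D1 D2 \<Phi> \<in> L2 D"
    using K_off_L2 \<Phi>(1) by metis
  then have "cmod (l2_inner D (K_off D1 D2 \<Phi>) \<Phi>) \<le> eps2 D1 D2"
    using l2_inner_le[OF _ \<Phi>(1)] eps2_bound[OF \<Phi>(1)] \<Phi>(2) by force
  moreover have "(eps2 D1 D2)\<^sup>2 / d \<le> eps2 D1 D2"
    using assms(3,4) eps by (simp add: divide_le_eq power2_eq_square mult_left_mono)
  then have "C1 * ((eps2 D1 D2)\<^sup>2 / d) \<le> C1 * eps2 D1 D2"
    using \<open>0 \<le> C1\<close> by (rule mult_left_mono)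
  ultimately show ?thesis
    using rem norm_triangle_sub[of \<delta> "l2_inner D (K_off D1 D2 \<Phi>) \<Phi>"] by (simp add: distrib_right)
qed

text \<open>
  Here \<open>\<sigma>\<close> and \<open>\<Psi>\<close> are the coupled eigenvalue and eigenfunction.  The four terms are those of the
  difference of the eigenvalue equations, and the factor \<open>2 / |\<rho>|\<close> bounds \<open>1 / |\<sigma>|\<close>.
\<close>

lemma eigenfunction_difference_pointwise:
  assumes L2: "\<Phi> \<in> L2 D" "\<Psi> \<in> L2 D" and norm: "l2_norm D \<Phi> = 1"
    and x: "x \<in> D"
    and eq: "K_diag D1 D2 \<Phi> x = \<rho> * \<Phi> x" "newton D \<Psi> x = \<sigma> * \<Psi> x"
    and "\<rho> \<noteq> 0" and half: "cmod (\<sigma> - \<rho>) \<le> cmod \<rho> / 2"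
  defines "\<eta> \<equiv> l2_norm D (\<lambda>y. \<Psi> y - \<Phi> y)"
  shows "cmod (\<Psi> x - \<Phi> x) \<le> 2 / cmod \<rho> *
    (C0_const D1 D2 * \<eta> + eps_inf D1 D2 + eps_inf D1 D2 * \<eta> +
     cmod (\<sigma> - \<rho>) * (C0_const D1 D2 / cmod \<rho>))" (is "_ \<le> _ * ?R")
proof -
  have cl: "x \<in> closure D"
    using x closure_subset by blast
  have diff: "(\<lambda>y. \<Psi> y - \<Phi> y) \<in> L2 D"
    using L2 by (intro L2_diff)
  have "\<sigma> * (\<Psi> x - \<Phi> x) = K_diag D1 D2 (\<lambda>y. \<Psi> y - \<Phi> y) x + K_off D1 D2 \<Phi> x
      + K_off D1 D2 (\<lambda>y. \<Psi> y - \<Phi> y) x - (\<sigma> - \<rho>) * \<Phi> x"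
  proof -
    have \<sigma>: "\<sigma> * \<Psi> x = K_diag D1 D2 \<Psi> x + K_off D1 D2 \<Psi> x"
      using newton_eq_K[OF L2(2) x] eq(2) by simp
    show ?thesis
      unfolding K_diff[OF L2(2,1)] eq(1) right_diff_distrib left_diff_distrib \<sigma> by simp
  qed
  then have "cmod \<sigma> * cmod (\<Psi> x - \<Phi> x)
      \<le> cmod (K_diag D1 D2 (\<lambda>y. \<Psi> y - \<Phi> y) x) + cmod (K_off D1 D2 \<Phi> x)
        + cmod (K_off D1 D2 (\<lambda>y. \<Psi> y - \<Phi> y) x) + cmod (\<sigma> - \<rho>) * cmod (\<Phi> x)"
    unfolding norm_mult[symmetric]
    by (simp only:) (intro order_trans[OF norm_triangle_ineq4] order_trans[OF norm_triangle_ineq]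
        add_mono order_refl)
  also have "\<dots> \<le> ?R"
  proof (intro add_mono mult_left_mono)
    show "cmod (\<Phi> x) \<le> C0_const D1 D2 / cmod \<rho>"
      using C0_const_bound[OF L2(1) cl] norm eq(1) \<open>\<rho> \<noteq> 0\<close>
      by (simp add: norm_mult le_divide_eq mult.commute)
  qed (use C0_const_bound[OF diff cl] eps_inf_bound[OF diff cl] eps_inf_bound[OF L2(1) cl] norm
       in \<open>auto simp: \<eta>_def\<close>)
  finally have R: "cmod \<sigma> * cmod (\<Psi> x - \<Phi> x) \<le> ?R" .
  have "cmod \<rho> / 2 \<le> cmod \<sigma>"
    using half norm_triangle_ineq2[of \<rho> \<sigma>] by (simp add: norm_minus_commute)
  then have "cmod \<rho> / 2 * cmod (\<Psi> x - \<Phi> x) \<le> ?R"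
    by (intro order_trans[OF mult_right_mono R]) auto
  then have "2 / cmod \<rho> * (cmod \<rho> / 2 * cmod (\<Psi> x - \<Phi> x)) \<le> 2 / cmod \<rho> * ?R"
    by (rule mult_left_mono) simp
  then show ?thesis
    using \<open>\<rho> \<noteq> 0\<close> by simp
qed

end

theorem corollary4p1p1:
  shows "\<exists>c::real. c > 0 \<and> (\<forall>C1::real. C1 > 0 \<longrightarrow> (\<exists>C::real. C > 0 \<and>
    (\<forall>(D1 :: (real^3) set) (D2 :: (real^3) set) (\<rho> :: complex) (\<Phi> :: real^3 \<Rightarrow> complex)
       (\<rho>\<^sub>\<kappa> :: complex) (\<Phi>\<^sub>\<kappa> :: real^3 \<Rightarrow> complex).
      bounded_domain D1 \<and> bounded_domain D2 \<and> setdist D1 D2 > 0 \<and>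
      simple_isolated_eigenvalue (D1 \<union> D2) (K_diag D1 D2) \<rho> \<and> d_gap D1 D2 \<rho> > 0 \<and>
      c0_eigenpair (D1 \<union> D2) (K_diag D1 D2) \<rho> \<Phi> \<and> l2_norm (D1 \<union> D2) \<Phi> = 1 \<and>
      eps2 D1 D2 \<le> c * d_gap D1 D2 \<rho> \<and>
      coupled_eigenpair D1 D2 C1 \<rho> \<Phi> \<rho>\<^sub>\<kappa> \<Phi>\<^sub>\<kappa> \<and>
      \<rho> \<noteq> 0 \<and> cmod (\<rho>\<^sub>\<kappa> - \<rho>) / cmod \<rho> \<le> 1 / 2 \<longrightarrow>
      c0_norm (D1 \<union> D2) (\<lambda>x. \<Phi>\<^sub>\<kappa> x - \<Phi> x) \<le>
        C * (C0_const D1 D2 / cmod \<rho> * (eps2 D1 D2 / d_gap D1 D2 \<rho>)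
             + eps_inf D1 D2 / cmod \<rho>
             + eps_inf D1 D2 / cmod \<rho> * (eps2 D1 D2 / d_gap D1 D2 \<rho>)
             + C0_const D1 D2 / (cmod \<rho>)\<^sup>2 * eps2 D1 D2))))"
proof (rule exI[of _ 1], rule conjI, simp, intro allI impI)
  fix C1 :: real
  assume C1: "0 < C1"
  show "\<exists>C>0. \<forall>D1 D2 \<rho> \<Phi> \<rho>\<^sub>\<kappa> \<Phi>\<^sub>\<kappa>.
      bounded_domain D1 \<and> bounded_domain D2 \<and> setdist D1 D2 > 0 \<and>
      simple_isolated_eigenvalue (D1 \<union> D2) (K_diag D1 D2) \<rho> \<and> d_gap D1 D2 \<rho> > 0 \<and>
      c0_eigenpair (D1 \<union> D2) (K_diag D1 D2) \<rho> \<Phi> \<and> l2_norm (D1 \<union> D2) \<Phi> = 1 \<and>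
      eps2 D1 D2 \<le> 1 * d_gap D1 D2 \<rho> \<and>
      coupled_eigenpair D1 D2 C1 \<rho> \<Phi> \<rho>\<^sub>\<kappa> \<Phi>\<^sub>\<kappa> \<and>
      \<rho> \<noteq> 0 \<and> cmod (\<rho>\<^sub>\<kappa> - \<rho>) / cmod \<rho> \<le> 1 / 2 \<longrightarrow>
      c0_norm (D1 \<union> D2) (\<lambda>x. \<Phi>\<^sub>\<kappa> x - \<Phi> x) \<le>
        C * (C0_const D1 D2 / cmod \<rho> * (eps2 D1 D2 / d_gap D1 D2 \<rho>)
             + eps_inf D1 D2 / cmod \<rho>
             + eps_inf D1 D2 / cmod \<rho> * (eps2 D1 D2 / d_gap D1 D2 \<rho>)
             + C0_const D1 D2 / (cmod \<rho>)\<^sup>2 * eps2 D1 D2)"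
  proof (rule exI[of _ "2 * (1 + C1)"], rule conjI, use C1 in simp, intro allI impI, elim conjE)
    fix D1 D2 :: "(real^3) set" and \<rho> \<rho>\<^sub>\<kappa> :: complex and \<Phi> \<Phi>\<^sub>\<kappa> :: cfun3
    assume dom: "bounded_domain D1" "bounded_domain D2" "setdist D1 D2 > 0"
      and d: "d_gap D1 D2 \<rho> > 0" "eps2 D1 D2 \<le> 1 * d_gap D1 D2 \<rho>"
      and \<Phi>: "c0_eigenpair (D1 \<union> D2) (K_diag D1 D2) \<rho> \<Phi>" "l2_norm (D1 \<union> D2) \<Phi> = 1"
      and coupled: "coupled_eigenpair D1 D2 C1 \<rho> \<Phi> \<rho>\<^sub>\<kappa> \<Phi>\<^sub>\<kappa>"
      and \<rho>: "\<rho> \<noteq> 0" "cmod (\<rho>\<^sub>\<kappa> - \<rho>) / cmod \<rho> \<le> 1 / 2"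
    interpret two_domains D1 D2
      using dom by unfold_locales
    define d where "d = d_gap D1 D2 \<rho>"
    define e where "e = eps2 D1 D2"
    define K where "K = C0_const D1 D2"
    define E where "E = eps_inf D1 D2"
    define \<eta> where "\<eta> = l2_norm D (\<lambda>y. \<Phi>\<^sub>\<kappa> y - \<Phi> y)"
    have L2: "\<Phi> \<in> L2 D" "\<Phi>\<^sub>\<kappa> \<in> L2 D"
      and cont: "continuous_on (closure D) \<Phi>" "continuous_on (closure D) \<Phi>\<^sub>\<kappa>"
      and eig: "AE x in lebesgue_on D. K_diag D1 D2 \<Phi> x = \<rho> * \<Phi> x"
        "AE x in lebesgue_on D. newton D \<Phi>\<^sub>\<kappa> x = \<rho>\<^sub>\<kappa> * \<Phi>\<^sub>\<kappa> x"
      and \<eta>: "\<eta> \<le> C1 * (e / d)"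
      and shift: "cmod (\<rho>\<^sub>\<kappa> - \<rho> - l2_inner D (K_off D1 D2 \<Phi>) \<Phi>) \<le> C1 * (e\<^sup>2 / d)"
      using \<Phi>(1) coupled
      unfolding coupled_eigenpair_def c0_eigenpair_def l2_eigenpair_def ae_eq_def Let_def
        \<eta>_def e_def d_def by blast+
    obtain x where x: "x \<in> closure D"
      using domain_facts(7) closure_subset by blast
    have nonneg: "0 \<le> K" "0 \<le> E" "0 \<le> e" "0 < d"
      using order_trans[OF norm_ge_zero C0_const_bound[OF L2(1) x]]
        order_trans[OF norm_ge_zero eps_inf_bound[OF L2(1) x]]
        order_trans[OF l2_norm_nonneg eps2_bound[OF L2(1)]] \<Phi>(2) d(1)
      by (simp_all add: K_def E_def e_def d_def)
    have shift_le: "cmod (\<rho>\<^sub>\<kappa> - \<rho>) \<le> (1 + C1) * e"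
      using eigenvalue_shift_le[OF L2(1) \<Phi>(2), of d C1 "\<rho>\<^sub>\<kappa> - \<rho>"] shift d C1 nonneg
      unfolding e_def d_def by simp
    have \<eta>_le: "\<eta> \<le> (1 + C1) * (e / d)"
      using \<eta> divide_nonneg_pos[OF nonneg(3,4)] by (simp only: distrib_right mult_1)
    have "AE x in lebesgue_on D. x \<in> D"
      by (rule AE_I2) simp
    with eig have "AE x in lebesgue_on D. cmod (\<Phi>\<^sub>\<kappa> x - \<Phi> x) \<le>
        2 / cmod \<rho> * (K * \<eta> + E + E * \<eta> + cmod (\<rho>\<^sub>\<kappa> - \<rho>) * (K / cmod \<rho>))"
    proof eventually_elim
      case (elim x)
      then show ?case
        using eigenfunction_difference_pointwise[OF L2 \<Phi>(2), of x \<rho> \<rho>\<^sub>\<kappa>] \<rho>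
        unfolding K_def E_def \<eta>_def by (simp add: divide_le_eq)
    qed
    then have "c0_norm D (\<lambda>x. \<Phi>\<^sub>\<kappa> x - \<Phi> x) \<le>
        2 / cmod \<rho> * (K * \<eta> + E + E * \<eta> + cmod (\<rho>\<^sub>\<kappa> - \<rho>) * (K / cmod \<rho>))"
      using domain_facts cont by (intro c0_norm_le_AE continuous_on_diff)
    also have "\<dots> \<le> 2 / cmod \<rho> * (K * ((1 + C1) * (e / d)) + (1 + C1) * E
        + E * ((1 + C1) * (e / d)) + (1 + C1) * e * (K / cmod \<rho>))"
      using \<eta>_le shift_le nonneg C1
      by (intro mult_left_mono[of _ _ "2 / cmod \<rho>"] add_mono mult_left_mono mult_right_mono)
         (auto simp: distrib_right)
    also have "\<dots> = 2 * (1 + C1) * (K / cmod \<rho> * (e / d) + E / cmod \<rho> + E / cmod \<rho> * (e / d)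
        + K / (cmod \<rho>)\<^sup>2 * e)"
      using \<rho>(1) nonneg(4) by (simp add: field_simps power2_eq_square)
    finally show "c0_norm (D1 \<union> D2) (\<lambda>x. \<Phi>\<^sub>\<kappa> x - \<Phi> x) \<le>
        2 * (1 + C1) * (C0_const D1 D2 / cmod \<rho> * (eps2 D1 D2 / d_gap D1 D2 \<rho>)
             + eps_inf D1 D2 / cmod \<rho>
             + eps_inf D1 D2 / cmod \<rho> * (eps2 D1 D2 / d_gap D1 D2 \<rho>)
             + C0_const D1 D2 / (cmod \<rho>)\<^sup>2 * eps2 D1 D2)"
      unfolding K_def E_def e_def d_def .
  qed
qed

end
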